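(* Let $1\le p\le 2$ and let $p_1$ be the conjugate exponent of $p$, i.e. $\frac1p+\frac1{p_1}=1$ (with $p_1=\infty$ if $p=1$). Let $\lambda>0$. If $f\in L_p(\mathbb{R})$, then $\mathbb{T}_\lambda f\in L_{p_1}(\mathbb{R})$ and $$\|\mathbb{T}_\lambda f\|_{L_{p_1}(\mathbb{R})}\le \mathcal{C}_1\,\|f\|_{L_p(\mathbb{R})},\qquad \mathcal{C}_1=C_1^{\frac{2}{p}-1}\left(\frac{C_1}{\sqrt{\lambda}}\right)^{2\left(1-\frac1p\right)},$$ where $C_1>0$ is a constant independent of $\lambda$ (and of $f$).
   Context: Let $a,b,c,d,e\in\mathbb{R}$ with $b\neq 0$, and let $Q(x,y)=ax^2+bxy+cy^2+dx+ey$. Let $\psi:\mathbb{R}^2\to\mathbb{C}$ be a smooth compactly supported function. The operator $\mathbb{T}_\lambda$ is defined by $$(\mathbb{T}_\lambda f)(x)=\int_{\mathbb{R}} e^{i\lambda Q(x,y)}\,\psi(x,y)\,f(y)\,dy .$$ It is introduced for $f\in C_0^\infty(\mathbb{R})$, and the same formula is used for $f\in L_p(\mathbb{R})$. The polynomial $Q$ and the function $\psi$ are fixed, and the constant $C_1$ may depend on them. *)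

theory Defs
  imports "HOL-Analysis.Analysis" "HOL-Probability.Essential_Supremum"
begin

text \<open>\<open>times_differentiable k f\<close>: all iterated directional derivatives of \<open>f\<close> of order less than
  \<open>k\<close> are (totally) differentiable everywhere, and those of order \<open>k\<close> are continuous; i.e. \<open>f\<close> is
  of class \<open>C\<^sup>k\<close>.\<close>

fun times_differentiable ::
  "nat \<Rightarrow> ('a::real_normed_vector \<Rightarrow> 'b::real_normed_vector) \<Rightarrow> bool" where
  "times_differentiable 0 f \<longleftrightarrow> continuous_on UNIV f"
| "times_differentiable (Suc k) f \<longleftrightarrow>
     (\<forall>x. f differentiable (at x)) \<and>
     (\<forall>v. times_differentiable k (\<lambda>x. frechet_derivative f (at x) v))"

definition smooth :: "('a::real_normed_vector \<Rightarrow> 'b::real_normed_vector) \<Rightarrow> bool" where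
  "smooth f \<longleftrightarrow> (\<forall>k. times_differentiable k f)"

definition compactly_supported :: "('a::topological_space \<Rightarrow> 'b::real_normed_vector) \<Rightarrow> bool" where
  "compactly_supported f \<longleftrightarrow> compact (closure (support_on UNIV f))"

text \<open>The spaces \<open>L\<^sub>p\<close> for \<open>1 \<le> p \<le> \<infinity>\<close>, with functions in place of classes modulo
  almost everywhere equality. \<open>Lp_norm\<close> is meaningful only for members of \<open>Lp_space\<close>.\<close>

definition Lp_space :: "ennreal \<Rightarrow> 'a measure \<Rightarrow> ('a \<Rightarrow> complex) set" where
  "Lp_space p M = {f \<in> borel_measurable M.
     if p = \<infinity> then esssup M (\<lambda>x. ennreal (norm (f x))) < \<infinity>
     else integrable M (\<lambda>x. norm (f x) powr enn2real p)}"

definition Lp_norm :: "ennreal \<Rightarrow> 'a measure \<Rightarrow> ('a \<Rightarrow> complex) \<Rightarrow> real" where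
  "Lp_norm p M f =
     (if p = \<infinity> then enn2real (esssup M (\<lambda>x. ennreal (norm (f x))))
      else (\<integral>x. norm (f x) powr enn2real p \<partial>M) powr (1 / enn2real p))"

definition Qphase :: "real \<Rightarrow> real \<Rightarrow> real \<Rightarrow> real \<Rightarrow> real \<Rightarrow> real \<Rightarrow> real \<Rightarrow> real" where
  "Qphase a b c d e x y = a * x\<^sup>2 + b * x * y + c * y\<^sup>2 + d * x + e * y"

text \<open>For smooth compactly supported \<open>\<psi>\<close> and \<open>f\<close> in \<open>L\<^sub>p\<close>, the integrand is integrable for every
  \<open>x\<close>, so the value 0 that the Bochner integral takes for non-integrable functions plays no role.\<close>

definition osc_op ::
  "(real \<Rightarrow> real \<Rightarrow> real) \<Rightarrow> (real \<times> real \<Rightarrow> complex) \<Rightarrow> real \<Rightarrow> (real \<Rightarrow> complex) \<Rightarrow> real \<Rightarrow> complex"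
where
  "osc_op Q \<psi> l f x =
     (\<integral>y. exp (\<i> * complex_of_real (l * Q x y)) * \<psi> (x, y) * f y \<partial>lebesgue)"

end

theory Submission
  imports Defs "HOL-Probability.Sinc_Integral"
begin

text \<open>The kernel of \<open>T\<^sup>* T\<close> is an oscillatory integral in \<open>x\<close> with phase \<open>\<lambda> b (y - y') x\<close> and a
  \<open>C\<^sup>2\<close> amplitude of compact support, so two integrations by parts bound it by a multiple of
  \<open>1 / (1 + (\<lambda> b (y - y'))\<^sup>2)\<close>. By Schur's test the \<open>L\<^sub>2\<close> norm of \<open>T\<close> is \<open>O(\<lambda>\<^sup>-\<^sup>1\<^sup>/\<^sup>2)\<close>, and trivially
  \<open>T\<close> maps \<open>L\<^sub>1\<close> to \<open>L\<^sub>\<infinity>\<close>.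

  Instead of the Riesz--Thorin theorem, a real interpolation argument is used, whose constant
  stays bounded up to both endpoints. For \<open>q > 2\<close>, \<open>\<bar>T f\<bar>\<^sup>q\<close> is a multiple of the integral of
  \<open>s\<^sup>q\<^sup>-\<^sup>3 (\<bar>T f\<bar> - s)\<^sub>+\<^sup>2\<close> over the levels \<open>s > 0\<close>. At level \<open>s\<close>, split \<open>f = f\<^sub>1 + f\<^sub>2\<close> at the height
  for which \<open>\<bar>T f\<^sub>1\<bar> \<le> s\<close>; then \<open>(\<bar>T f\<bar> - s)\<^sub>+ \<le> \<bar>T f\<^sub>2\<bar>\<close> and the \<open>L\<^sub>2\<close> bound applies to the bounded
  part \<open>f\<^sub>2\<close>.\<close>

section \<open>Interpolation between \<open>L\<^sub>1 \<rightarrow> L\<^sub>\<infinity>\<close> and \<open>L\<^sub>2 \<rightarrow> L\<^sub>2\<close>\<close>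

lemma nn_integral_powr_from_0:
  fixes a c :: real
  assumes "a > -1" "c \<ge> 0"
  shows "(\<integral>\<^sup>+s. ennreal (if 0 < s \<and> s \<le> c then s powr a else 0) \<partial>lborel) = ennreal (c powr (a + 1) / (a + 1))"
proof (rule nn_integral_has_integral_lborel)
  have "((\<lambda>s. if s \<in> {0..c} then s powr a else 0) has_integral (c powr (a + 1) / (a + 1))) UNIV"
    using has_integral_powr_from_0[OF assms] by (simp only: has_integral_restrict_UNIV)
  then show "((\<lambda>s. if 0 < s \<and> s \<le> c then s powr a else 0) has_integral (c powr (a + 1) / (a + 1))) UNIV"
    by (rule has_integral_eq[rotated]) auto
qed auto

text \<open>After scaling by \<open>v\<close> this is the Beta integral B(q - 2, 3). The square
  matches the L2 bound applied at each level, and \<open>q > 2\<close> makes the exponent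
  \<open>q - 3\<close> integrable at 0.\<close>

lemma nn_integral_powr_times_square:
  fixes q v :: real
  assumes "q > 2" "v \<ge> 0"
  shows "(\<integral>\<^sup>+s. ennreal (if 0 < s \<and> s \<le> v then s powr (q - 3) * (v - s)\<^sup>2 else 0) \<partial>lborel)
    = ennreal (2 / (q * (q - 1) * (q - 2)) * v powr q)"
proof (rule nn_integral_has_integral_lborel)
  have 1: "((\<lambda>s. s powr (q - 3)) has_integral (v powr (q - 2) / (q - 2))) {0..v}"
    using has_integral_powr_from_0[of "q - 3" v] assms by (simp add: algebra_simps)
  have 2: "((\<lambda>s. s powr (q - 2)) has_integral (v powr (q - 1) / (q - 1))) {0..v}"
    using has_integral_powr_from_0[of "q - 2" v] assms by (simp add: algebra_simps)
  have 3: "((\<lambda>s. s powr (q - 1)) has_integral (v powr q / q)) {0..v}"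
    using has_integral_powr_from_0[of "q - 1" v] assms by (simp add: algebra_simps)
  have v1: "v * v powr (q - 1) = v powr q" "v\<^sup>2 * v powr (q - 2) = v powr q"
    using assms powr_add[of v "q - 1" 1] powr_add[of v "q - 2" 2]
    by (cases "v = 0"; simp add: powr_numeral mult.commute)+
  have "((\<lambda>s. v\<^sup>2 * s powr (q - 3) - 2 * v * s powr (q - 2) + s powr (q - 1)) has_integral
     (v\<^sup>2 * (v powr (q - 2) / (q - 2)) - 2 * v * (v powr (q - 1) / (q - 1)) + v powr q / q)) {0..v}"
    by (intro has_integral_add has_integral_diff has_integral_mult_right 1 2 3)
  also have "v\<^sup>2 * (v powr (q - 2) / (q - 2)) - 2 * v * (v powr (q - 1) / (q - 1)) + v powr q / q
     = v powr q / (q - 2) - 2 * v powr q / (q - 1) + v powr q / q"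
    by (simp add: v1 mult.assoc)
  also have "\<dots> = 2 / (q * (q - 1) * (q - 2)) * v powr q"
    using assms by (simp add: divide_simps) (simp add: algebra_simps)
  finally have "((\<lambda>s. if s \<in> {0..v} then v\<^sup>2 * s powr (q - 3) - 2 * v * s powr (q - 2) + s powr (q - 1) else 0)
     has_integral (2 / (q * (q - 1) * (q - 2)) * v powr q)) UNIV"
    by (simp only: has_integral_restrict_UNIV)
  moreover have "(if s \<in> {0..v} then v\<^sup>2 * s powr (q - 3) - 2 * v * s powr (q - 2) + s powr (q - 1) else 0)
     = (if 0 < s \<and> s \<le> v then s powr (q - 3) * (v - s)\<^sup>2 else 0)" for s
  proof -
    have "s powr (q - 2) = s powr (q - 3) * s" "s powr (q - 1) = s powr (q - 3) * s\<^sup>2" if "0 < s"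
      using that powr_add[of s "q - 3" 1] powr_add[of s "q - 3" 2] by (simp_all add: powr_numeral)
    then show ?thesis by (auto simp: power2_eq_square algebra_simps)
  qed
  ultimately show "((\<lambda>s. if 0 < s \<and> s \<le> v then s powr (q - 3) * (v - s)\<^sup>2 else 0) has_integral
      2 / (q * (q - 1) * (q - 2)) * v powr q) UNIV"
    by simp
qed auto

text \<open>The point of the constant is its uniformity. The integral over levels produces a factor
  1 / (q - 2), which the normalisation \<open>c\<close> cancels, so nothing blows up as q tends to
  2; the remaining q (q - 1) / 2 has a bounded q-th root. Subadditivity is only asked for sums of an
  L1 and an L2 function, because an operator given by Bochner integrals is additive only where both
  integrals exist.\<close>

lemma interpolation_L1_L2:
  fixes T :: "('a \<Rightarrow> complex) \<Rightarrow> 'b \<Rightarrow> complex" and A B n p q :: real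
  assumes M: "sigma_finite_measure M" and N: "sigma_finite_measure N"
    and q: "q > 2" and p: "p = q / (q - 1)" and A: "A > 0" and B: "B \<ge> 0" and n: "n \<ge> 0"
    and meas: "\<And>g. g \<in> borel_measurable M \<Longrightarrow> T g \<in> borel_measurable N"
    and subadd: "\<And>g h x. g \<in> borel_measurable M \<Longrightarrow> h \<in> borel_measurable M \<Longrightarrow>
       (\<integral>\<^sup>+y. ennreal (norm (g y)) \<partial>M) < \<infinity> \<Longrightarrow> (\<integral>\<^sup>+y. ennreal ((norm (h y))\<^sup>2) \<partial>M) < \<infinity> \<Longrightarrow>
       norm (T (\<lambda>y. g y + h y) x) \<le> norm (T g x) + norm (T h x)"
    and bound1: "\<And>g x. g \<in> borel_measurable M \<Longrightarrow>
       ennreal (norm (T g x)) \<le> ennreal A * (\<integral>\<^sup>+y. ennreal (norm (g y)) \<partial>M)"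
    and bound2: "\<And>g. g \<in> borel_measurable M \<Longrightarrow>
       (\<integral>\<^sup>+x. ennreal ((norm (T g x))\<^sup>2) \<partial>N) \<le> ennreal B * (\<integral>\<^sup>+y. ennreal ((norm (g y))\<^sup>2) \<partial>M)"
    and f: "f \<in> borel_measurable M"
    and fn: "(\<integral>\<^sup>+y. ennreal (norm (f y) powr p) \<partial>M) = ennreal n"
  shows "(\<integral>\<^sup>+x. ennreal (norm (T f x) powr q) \<partial>N)
    \<le> ennreal (q * (q - 1) / 2 * B * A powr (q - 2) * n powr (q - 1))"
proof (cases "n = 0")
  \<comment> \<open>For \<open>n = 0\<close> the splitting height would be 0; here \<open>f\<close>
    vanishes almost everywhere, so \<open>bound1\<close> alone suffices.\<close>
  case True
  note [measurable] = f
  have "AE y in M. ennreal (norm (f y) powr p) = 0"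
    using fn True by (simp add: nn_integral_0_iff_AE)
  then have "AE y in M. ennreal (norm (f y)) = 0" by simp
  then have "(\<integral>\<^sup>+y. ennreal (norm (f y)) \<partial>M) = 0"
    by (subst nn_integral_0_iff_AE) auto
  then have "norm (T f x) = 0" for x using bound1[OF f, of x] by simp
  then show ?thesis by simp
next
  case False
  then have n: "n > 0" using n by simp
  interpret N: sigma_finite_measure N by fact
  interpret M: sigma_finite_measure M by fact
  interpret NP: pair_sigma_finite N lborel ..
  interpret MP: pair_sigma_finite M lborel ..
  note [measurable] = f meas[OF f]
  \<comment> \<open>The reciprocal of the constant in
    \<open>nn_integral_powr_times_square\<close>.\<close>
  define c where "c = q * (q - 1) * (q - 2) / 2"
  \<comment> \<open>The splitting height: \<open>A * n * \<gamma> s powr (1 - p) = s\<close>, so Chebyshev's inequality bounds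
    \<open>A\<close> times the \<open>L\<^sub>1\<close> norm of the tall part \<open>f1 s\<close> by \<open>s\<close>.\<close>
  define \<gamma> where "\<gamma> s = (A * n / s) powr (q - 1)" for s
  define f1 where "f1 s y = (if norm (f y) \<le> \<gamma> s then 0 else f y)" for s y
  define f2 where "f2 s y = (if norm (f y) \<le> \<gamma> s then f y else 0)" for s y
  have [measurable]: "f1 s \<in> borel_measurable M" "f2 s \<in> borel_measurable M" for s
    unfolding f1_def f2_def by measurable
  have c: "c > 0" using q unfolding c_def by simp
  have p1: "p - 1 = 1 / (q - 1)" "p > 1" "p < 2" using q unfolding p by (auto simp: field_simps)
  have f1_L1: "ennreal A * (\<integral>\<^sup>+y. ennreal (norm (f1 s y)) \<partial>M) \<le> ennreal s" if s: "s > 0" for s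
  proof -
    have \<gamma>: "\<gamma> s > 0" using A n s unfolding \<gamma>_def by simp
    have g1: "\<gamma> s powr (1 - p) = s / (A * n)"
      unfolding \<gamma>_def powr_powr using A n s p1 q
      by (simp add: p field_simps powr_minus_divide)
    have le: "norm (f1 s y) \<le> \<gamma> s powr (1 - p) * norm (f y) powr p" for y
    proof (cases "norm (f y) \<le> \<gamma> s")
      case False
      then have "norm (f y) powr (1 - p) \<le> \<gamma> s powr (1 - p)"
        using \<gamma> p1 by (intro powr_mono2') auto
      then have "norm (f y) powr (1 - p) * norm (f y) powr p \<le> \<gamma> s powr (1 - p) * norm (f y) powr p"
        by (rule mult_right_mono) auto
      moreover have "norm (f y) powr (1 - p) * norm (f y) powr p = norm (f y)"
        using False \<gamma> by (subst powr_add[symmetric]) simp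
      ultimately show ?thesis using False by (simp add: f1_def)
    qed (simp add: f1_def)
    have "(\<integral>\<^sup>+y. ennreal (norm (f1 s y)) \<partial>M) \<le> (\<integral>\<^sup>+y. ennreal (\<gamma> s powr (1 - p)) * ennreal (norm (f y) powr p) \<partial>M)"
      by (intro nn_integral_mono) (auto simp: ennreal_mult[symmetric] intro!: ennreal_leI le)
    also have "\<dots> = ennreal (\<gamma> s powr (1 - p)) * ennreal n"
      by (subst nn_integral_cmult) (auto simp: fn)
    finally have "ennreal A * (\<integral>\<^sup>+y. ennreal (norm (f1 s y)) \<partial>M) \<le> ennreal A * (ennreal (\<gamma> s powr (1 - p)) * ennreal n)"
      by (rule mult_left_mono) simp
    also have "\<dots> = ennreal (A * (s / (A * n) * n))"
      using A n s by (simp add: g1 ennreal_mult[symmetric])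
    also have "\<dots> = ennreal s" using A n by simp
    finally show ?thesis .
  qed
  \<comment> \<open>This finiteness only licenses \<open>subadd\<close>; the quantitative use of
    \<open>f2 s\<close> comes after integrating over the levels.\<close>
  have f2_L2: "(\<integral>\<^sup>+y. ennreal ((norm (f2 s y))\<^sup>2) \<partial>M) < \<infinity>" for s
  proof -
    have le: "(norm (f2 s y))\<^sup>2 \<le> \<gamma> s powr (2 - p) * norm (f y) powr p" for y
    proof (cases "norm (f y) \<le> \<gamma> s \<and> norm (f y) > 0")
      case True
      then have "norm (f y) powr (2 - p) \<le> \<gamma> s powr (2 - p)"
        using p1 by (intro powr_mono2) auto
      then have "norm (f y) powr (2 - p) * norm (f y) powr p \<le> \<gamma> s powr (2 - p) * norm (f y) powr p"
        by (rule mult_right_mono) auto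
      moreover have "norm (f y) powr (2 - p) * norm (f y) powr p = (norm (f y))\<^sup>2"
        using True by (subst powr_add[symmetric]) (simp add: powr_numeral)
      ultimately show ?thesis using True by (simp add: f2_def)
    qed (auto simp: f2_def)
    have "(\<integral>\<^sup>+y. ennreal ((norm (f2 s y))\<^sup>2) \<partial>M) \<le> (\<integral>\<^sup>+y. ennreal (\<gamma> s powr (2 - p)) * ennreal (norm (f y) powr p) \<partial>M)"
      by (intro nn_integral_mono) (auto simp: ennreal_mult[symmetric] intro!: ennreal_leI le)
    also have "\<dots> = ennreal (\<gamma> s powr (2 - p)) * ennreal n"
      by (subst nn_integral_cmult) (auto simp: fn)
    also have "\<dots> < \<infinity>" by (simp add: ennreal_mult_less_top)
    finally show ?thesis .
  qed
  have level: "(\<integral>\<^sup>+x. ennreal (if 0 < s \<and> s \<le> norm (T f x) then s powr (q - 3) * (norm (T f x) - s)\<^sup>2 else 0) \<partial>N)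
     \<le> (\<integral>\<^sup>+y. ennreal B * ennreal (if 0 < s \<and> norm (f y) \<le> \<gamma> s then s powr (q - 3) * (norm (f y))\<^sup>2 else 0) \<partial>M)" for s
  proof (cases "s > 0")
    case s: True
    have T1: "norm (T (f1 s) x) \<le> s" for x
      using order_trans[OF bound1[of "f1 s" x] f1_L1[OF s]] s by simp
    have "(\<integral>\<^sup>+y. ennreal (norm (f1 s y)) \<partial>M) \<noteq> top"
      using f1_L1[OF s] A by (auto simp: ennreal_mult_top top_unique)
    then have "norm (T (\<lambda>y. f1 s y + f2 s y) x) \<le> norm (T (f1 s) x) + norm (T (f2 s) x)" for x
      using f2_L2[of s] by (intro subadd) (auto simp: less_top)
    moreover have "(\<lambda>y. f1 s y + f2 s y) = f" by (auto simp: f1_def f2_def)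
    ultimately have T2: "norm (T f x) - s \<le> norm (T (f2 s) x)" for x
      using T1[of x] by (smt (verit))
    have "(\<integral>\<^sup>+x. ennreal (if 0 < s \<and> s \<le> norm (T f x) then s powr (q - 3) * (norm (T f x) - s)\<^sup>2 else 0) \<partial>N)
      \<le> (\<integral>\<^sup>+x. ennreal (s powr (q - 3)) * ennreal ((norm (T (f2 s) x))\<^sup>2) \<partial>N)"
      using T2 by (intro nn_integral_mono)
        (auto simp: ennreal_mult[symmetric] intro!: ennreal_leI mult_left_mono power_mono)
    also have "\<dots> = ennreal (s powr (q - 3)) * (\<integral>\<^sup>+x. ennreal ((norm (T (f2 s) x))\<^sup>2) \<partial>N)"
      by (rule nn_integral_cmult) (use meas[of "f2 s"] in measurable)
    also have "\<dots> \<le> ennreal (s powr (q - 3)) * (ennreal B * (\<integral>\<^sup>+y. ennreal ((norm (f2 s y))\<^sup>2) \<partial>M))"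
      by (intro mult_left_mono bound2) auto
    also have "\<dots> = (\<integral>\<^sup>+y. ennreal (s powr (q - 3)) * (ennreal B * ennreal ((norm (f2 s y))\<^sup>2)) \<partial>M)"
      by (simp add: nn_integral_cmult)
    also have "\<dots> = (\<integral>\<^sup>+y. ennreal B * ennreal (if 0 < s \<and> norm (f y) \<le> \<gamma> s then s powr (q - 3) * (norm (f y))\<^sup>2 else 0) \<partial>M)"
      using s B by (intro nn_integral_cong) (auto simp: f2_def ennreal_mult[symmetric] mult_ac)
    finally show ?thesis .
  qed simp
  \<comment> \<open>For fixed \<open>y\<close> the admissible levels form an interval from 0 to
    \<open>\<sigma>\<close>, since \<open>\<gamma>\<close> is decreasing in \<open>s\<close>. What
    remains is a pure power integral, and the identity \<open>e\<close> collects the powers of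
    \<open>norm (f y)\<close> into exponent \<open>p\<close>.\<close>
  have inner: "(\<integral>\<^sup>+s. ennreal (if 0 < s \<and> norm (f y) \<le> \<gamma> s then s powr (q - 3) * (norm (f y))\<^sup>2 else 0) \<partial>lborel)
     = ennreal ((A * n) powr (q - 2) / (q - 2) * norm (f y) powr p)" for y
  proof (cases "f y = 0")
    case False
    define t where "t = norm (f y)"
    have t: "t > 0" using False by (simp add: t_def)
    define \<sigma> where "\<sigma> = A * n * t powr (1 - p)"
    have \<sigma>: "\<sigma> > 0" using A n t by (simp add: \<sigma>_def)
    have iff: "t \<le> \<gamma> s \<longleftrightarrow> s \<le> \<sigma>" if s: "s > 0" for s
    proof -
      have "\<gamma> s \<ge> 0" by (simp add: \<gamma>_def)
      then have "t \<le> \<gamma> s \<longleftrightarrow> t powr (p - 1) \<le> \<gamma> s powr (p - 1)"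
        using t p1 powr_mono2[of "p - 1" t "\<gamma> s"] powr_less_mono2[of "p - 1" "\<gamma> s" t]
        by linarith
      also have "\<gamma> s powr (p - 1) = A * n / s"
        using A n s q p1 by (simp add: \<gamma>_def powr_powr)
      also have "t powr (p - 1) \<le> A * n / s \<longleftrightarrow> s * t powr (p - 1) \<le> A * n"
        using s by (simp add: field_simps)
      also have "\<dots> \<longleftrightarrow> s \<le> \<sigma>"
        using t by (simp add: \<sigma>_def powr_diff field_simps)
      finally show ?thesis .
    qed
    have e: "(1 - p) * (q - 2) + 2 = p" using q by (simp add: p field_simps)
    have "(\<integral>\<^sup>+s. ennreal (if 0 < s \<and> t \<le> \<gamma> s then s powr (q - 3) * t\<^sup>2 else 0) \<partial>lborel)
      = (\<integral>\<^sup>+s. ennreal (t\<^sup>2) * ennreal (if 0 < s \<and> s \<le> \<sigma> then s powr (q - 3) else 0) \<partial>lborel)"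
      using iff by (intro nn_integral_cong) (auto simp: ennreal_mult[symmetric] mult_ac)
    also have "\<dots> = ennreal (t\<^sup>2) * ennreal (\<sigma> powr (q - 2) / (q - 2))"
      using q \<sigma> by (subst nn_integral_cmult) (auto simp: nn_integral_powr_from_0 algebra_simps)
    also have "\<dots> = ennreal (t\<^sup>2 * (\<sigma> powr (q - 2) / (q - 2)))"
      using q by (simp add: ennreal_mult[symmetric])
    also have "t\<^sup>2 * (\<sigma> powr (q - 2) / (q - 2)) = (A * n) powr (q - 2) / (q - 2) * (t powr ((1 - p) * (q - 2)) * t powr 2)"
      using A n t by (simp add: \<sigma>_def powr_mult powr_powr powr_numeral)
    also have "t powr ((1 - p) * (q - 2)) * t powr 2 = t powr p"
      using e by (subst powr_add[symmetric]) simp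
    finally show ?thesis by (simp only: t_def)
  qed (simp cong: if_cong)
  have "(\<integral>\<^sup>+x. ennreal (norm (T f x) powr q) \<partial>N)
     = (\<integral>\<^sup>+x. ennreal c * (\<integral>\<^sup>+s. ennreal (if 0 < s \<and> s \<le> norm (T f x) then s powr (q - 3) * (norm (T f x) - s)\<^sup>2 else 0) \<partial>lborel) \<partial>N)"
    using q c by (intro nn_integral_cong)
      (simp add: nn_integral_powr_times_square ennreal_mult[symmetric] c_def)
  also have "\<dots> = ennreal c * (\<integral>\<^sup>+x. (\<integral>\<^sup>+s. ennreal (if 0 < s \<and> s \<le> norm (T f x) then s powr (q - 3) * (norm (T f x) - s)\<^sup>2 else 0) \<partial>lborel) \<partial>N)"
    by (rule nn_integral_cmult) measurable
  \<comment> \<open>Tonelli is applied twice: here to bring the level outside, where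
    \<open>level\<close> bounds the integral over \<open>x\<close>, and then to integrate over the
    level first, where \<open>inner\<close> applies.\<close>
  also have "\<dots> = ennreal c * (\<integral>\<^sup>+s. (\<integral>\<^sup>+x. ennreal (if 0 < s \<and> s \<le> norm (T f x) then s powr (q - 3) * (norm (T f x) - s)\<^sup>2 else 0) \<partial>N) \<partial>lborel)"
    by (subst NP.Fubini') auto
  also have "\<dots> \<le> ennreal c * (\<integral>\<^sup>+s. (\<integral>\<^sup>+y. ennreal B * ennreal (if 0 < s \<and> norm (f y) \<le> \<gamma> s then s powr (q - 3) * (norm (f y))\<^sup>2 else 0) \<partial>M) \<partial>lborel)"
    by (intro mult_left_mono nn_integral_mono level) auto
  also have "\<dots> = ennreal c * (\<integral>\<^sup>+y. (\<integral>\<^sup>+s. ennreal B * ennreal (if 0 < s \<and> norm (f y) \<le> \<gamma> s then s powr (q - 3) * (norm (f y))\<^sup>2 else 0) \<partial>lborel) \<partial>M)"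
    unfolding \<gamma>_def by (subst MP.Fubini') auto
  also have "\<dots> = ennreal c * (\<integral>\<^sup>+y. ennreal B * (\<integral>\<^sup>+s. ennreal (if 0 < s \<and> norm (f y) \<le> \<gamma> s then s powr (q - 3) * (norm (f y))\<^sup>2 else 0) \<partial>lborel) \<partial>M)"
    unfolding \<gamma>_def by (subst nn_integral_cmult) auto
  also have "\<dots> = ennreal c * (\<integral>\<^sup>+y. ennreal (B * ((A * n) powr (q - 2) / (q - 2))) * ennreal (norm (f y) powr p) \<partial>M)"
    unfolding inner using B q by (simp add: ennreal_mult[symmetric] mult_ac)
  also have "\<dots> = ennreal c * (ennreal (B * ((A * n) powr (q - 2) / (q - 2))) * ennreal n)"
    by (subst nn_integral_cmult) (auto simp: fn)
  also have "\<dots> = ennreal (c * (B * ((A * n) powr (q - 2) / (q - 2)) * n))"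
    using c B q n by (simp add: ennreal_mult[symmetric])
  \<comment> \<open>Here the factor \<open>q - 2\<close> in \<open>c\<close> cancels the singular
    denominator.\<close>
  also have "c * (B * ((A * n) powr (q - 2) / (q - 2)) * n) = q * (q - 1) / 2 * B * A powr (q - 2) * (n powr (q - 2) * n)"
  proof -
    have "c = q * (q - 1) / 2 * (q - 2)" by (simp add: c_def)
    then have "c / (q - 2) = q * (q - 1) / 2"
      using q nonzero_mult_div_cancel_right[of "q - 2" "q * (q - 1) / 2"] by (simp only:)
    moreover have "c * (B * ((A * n) powr (q - 2) / (q - 2)) * n) = c / (q - 2) * (B * (A * n) powr (q - 2) * n)"
      by simp
    ultimately have "c * (B * ((A * n) powr (q - 2) / (q - 2)) * n) = q * (q - 1) / 2 * (B * (A * n) powr (q - 2) * n)"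
      by (simp only:)
    then show ?thesis using A n by (simp add: powr_mult mult.assoc)
  qed
  also have "n powr (q - 2) * n = n powr (q - 1)"
    using n powr_add[of n "q - 2" 1] by simp
  finally show ?thesis by simp
qed

section \<open>The \<open>L\<^sub>2\<close> estimate\<close>

lemma nn_integral_inverse_1_plus_square:
  "(\<integral>\<^sup>+x. ennreal (1 / (1 + x\<^sup>2)) \<partial>lborel) = ennreal pi"
proof -
  have int: "integrable lborel (\<lambda>x::real. 1 / (1 + x\<^sup>2))"
    using integrable_inverse_1_plus_square by (simp add: set_integrable_def inverse_eq_divide)
  have "(\<integral>x. 1 / (1 + x\<^sup>2) \<partial>lborel) = pi"
    using LBINT_inverse_1_plus_square
    by (simp add: interval_lebesgue_integral_def set_lebesgue_integral_def inverse_eq_divide)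
  then show ?thesis
    by (subst nn_integral_eq_integral[OF int]) (auto simp: add_nonneg_nonneg)
qed

lemma nn_integral_inverse_1_plus_scaled_square:
  fixes k C :: real
  assumes "k \<noteq> 0" "C \<ge> 0"
  shows "(\<integral>\<^sup>+x. ennreal (C / (1 + (k * x)\<^sup>2)) \<partial>lborel) = ennreal (C * pi / \<bar>k\<bar>)"
proof -
  have "(\<integral>\<^sup>+x. ennreal (C / (1 + (k * x)\<^sup>2)) \<partial>lborel)
     = ennreal C * (\<integral>\<^sup>+x. ennreal (1 / (1 + (k * x)\<^sup>2)) \<partial>lborel)"
    using assms by (subst nn_integral_cmult[symmetric]) (auto simp: ennreal_mult[symmetric])
  also have "ennreal \<bar>k\<bar> * (\<integral>\<^sup>+x. ennreal (1 / (1 + (k * x)\<^sup>2)) \<partial>lborel) = ennreal pi"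
    using nn_integral_real_affine[of "\<lambda>x. ennreal (1 / (1 + x\<^sup>2))" k 0] assms
    by (simp add: nn_integral_inverse_1_plus_square)
  then have "ennreal (1 / \<bar>k\<bar>) * (ennreal \<bar>k\<bar> * (\<integral>\<^sup>+x. ennreal (1 / (1 + (k * x)\<^sup>2)) \<partial>lborel))
     = ennreal (pi / \<bar>k\<bar>)"
    by (simp add: ennreal_mult[symmetric])
  then have "(\<integral>\<^sup>+x. ennreal (1 / (1 + (k * x)\<^sup>2)) \<partial>lborel) = ennreal (pi / \<bar>k\<bar>)"
    using assms by (simp add: mult.assoc[symmetric] ennreal_mult[symmetric])
  finally show ?thesis using assms by (simp add: ennreal_mult[symmetric])
qed

text \<open>Integrating by parts twice replaces m^2 g by - g'' under the integral. Adding the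
  integral of E g itself gives (1 + m^2) times the integral as the integral of E (g - g''), with no
  division by \<open>m\<close>, so small \<open>m\<close> and \<open>m = 0\<close> need no separate
  treatment.\<close>

lemma oscillatory_integral_bound:
  fixes g g' g'' :: "real \<Rightarrow> complex" and m r B0 B2 :: real
  assumes g: "\<And>x. (g has_vector_derivative g' x) (at x)"
    and g': "\<And>x. (g' has_vector_derivative g'' x) (at x)"
    and g'': "continuous_on UNIV g''"
    and r: "r \<ge> 0" and zero: "\<And>x. \<bar>x\<bar> \<ge> r \<Longrightarrow> g x = 0" "\<And>x. \<bar>x\<bar> \<ge> r \<Longrightarrow> g' x = 0"
    and B0: "\<And>x. norm (g x) \<le> B0" and B2: "\<And>x. norm (g'' x) \<le> B2"
  shows "norm (\<integral>x. exp (\<i> * of_real (m * x)) * g x \<partial>lborel) \<le> 2 * r * (B0 + B2) / (1 + m\<^sup>2)"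
proof -
  \<comment> \<open>\<open>F\<close> carries out both integrations by parts at once: \<open>F' = - E (m\<^sup>2 g + g'')\<close>.\<close>
  define E where "E x = exp (\<i> * of_real (m * x))" for x :: real
  define F where "F x = E x * (\<i> * of_real m * g x - g' x)" for x
  have E: "(E has_vector_derivative (\<i> * of_real m * E x)) (at x)" for x
  proof -
    have "((\<lambda>z. exp (\<i> * (of_real m * z))) has_field_derivative \<i> * of_real m * exp (\<i> * (of_real m * of_real x))) (at (of_real x))"
      by (auto intro!: derivative_eq_intros)
    from has_vector_derivative_real_field[OF this] show ?thesis by (simp add: E_def[abs_def])
  qed
  have F: "(F has_vector_derivative - (E x * (of_real (m\<^sup>2) * g x + g'' x))) (at x)" for x
    unfolding F_def
    by (rule derivative_eq_intros E g g' refl | simp)+ (simp add: algebra_simps power2_eq_square)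
  have cont_g: "continuous_on S g" "continuous_on S E" "continuous_on S g''" for S
  proof -
    show "continuous_on S g" "continuous_on S E"
      using g E by (blast intro: continuous_at_imp_continuous_on has_vector_derivative_continuous)+
    show "continuous_on S g''" using g'' by (rule continuous_on_subset) simp
  qed
  define h where "h x = indicator {-r..r} x *\<^sub>R (E x * g x)" for x
  define k where "k x = indicator {-r..r} x *\<^sub>R (- (E x * (of_real (m\<^sup>2) * g x + g'' x)))" for x
  have k: "has_bochner_integral lborel k (F r - F (- r))"
    unfolding k_def using r
    by (intro has_bochner_integral_FTC_Icc has_vector_derivative_at_within[OF F])
       (auto intro!: continuous_intros cont_g)
  \<comment> \<open>The vanishing hypotheses include the points where
    \<open>\<bar>x\<bar> = r\<close>, so there are no boundary terms.\<close>
  moreover have "F r - F (- r) = 0" using zero r by (simp add: F_def)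
  ultimately have k: "integrable lborel k" "(\<integral>x. k x \<partial>lborel) = 0"
    by (auto simp: has_bochner_integral_iff)
  have h: "integrable lborel h"
    unfolding h_def by (intro borel_integrable_compact) (auto intro!: continuous_intros cont_g)
  have Eg: "E x * g x = h x" for x
    using zero[of x] by (cases "\<bar>x\<bar> \<ge> r") (auto simp: h_def indicator_def)
  \<comment> \<open>Since \<open>k\<close> has integral 0, adding it changes nothing in the
    integral, but it trades the growing factor m^2 for \<open>g''\<close>.\<close>
  have hk: "of_real (1 + m\<^sup>2) * h x + k x = indicator {-r..r} x *\<^sub>R (E x * (g x - g'' x))" for x
    by (simp add: h_def k_def indicator_def algebra_simps)
  have "(1 + m\<^sup>2) * norm (\<integral>x. h x \<partial>lborel) = norm (of_real (1 + m\<^sup>2) * (\<integral>x. h x \<partial>lborel))"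
    unfolding norm_mult norm_of_real by simp
  also have "of_real (1 + m\<^sup>2) * (\<integral>x. h x \<partial>lborel) = (\<integral>x. of_real (1 + m\<^sup>2) * h x + k x \<partial>lborel)"
    by (subst Bochner_Integration.integral_add) (auto simp: h k)
  also have "norm \<dots> \<le> (\<integral>x. indicator {-r..r} x * (B0 + B2) \<partial>lborel)"
  proof (rule Bochner_Integration.integral_norm_bound_integral)
    show "integrable lborel (\<lambda>x. of_real (1 + m\<^sup>2) * h x + k x)"
      by (intro Bochner_Integration.integrable_add integrable_mult_right h k)
    show "integrable lborel (\<lambda>x. indicator {-r..r} x * (B0 + B2))"
      by (intro integrable_mult_left integrable_real_indicator) (auto simp: emeasure_lborel_Icc_eq)
    have "norm (g x - g'' x) \<le> B0 + B2" for x
      using B0[of x] B2[of x] norm_triangle_ineq4[of "g x" "g'' x"] by linarith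
    then show "norm (of_real (1 + m\<^sup>2) * h x + k x) \<le> indicator {-r..r} x * (B0 + B2)" for x
      unfolding hk by (simp add: indicator_def norm_mult E_def)
  qed
  also have "\<dots> = 2 * r * (B0 + B2)"
    using r by simp
  finally show ?thesis
    unfolding Eg[symmetric] E_def by (simp add: pos_le_divide_eq add_pos_nonneg mult.commute)
qed

section \<open>Schur's test for the correlation kernel\<close>

lemma (in pair_sigma_finite) integral_times_integral:
  fixes u v :: "_ \<Rightarrow> complex"
  assumes "integrable M1 u" "integrable M2 v"
  shows "integrable (M1 \<Otimes>\<^sub>M M2) (\<lambda>(x, y). u x * v y)"
    and "(\<integral>(x, y). u x * v y \<partial>(M1 \<Otimes>\<^sub>M M2)) = (\<integral>x. u x \<partial>M1) * (\<integral>y. v y \<partial>M2)"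
proof -
  note [measurable] = assms[THEN borel_measurable_integrable]
  show i: "integrable (M1 \<Otimes>\<^sub>M M2) (\<lambda>(x, y). u x * v y)"
    using assms by (intro Fubini_integrable) (auto simp: norm_mult)
  show "(\<integral>(x, y). u x * v y \<partial>(M1 \<Otimes>\<^sub>M M2)) = (\<integral>x. u x \<partial>M1) * (\<integral>y. v y \<partial>M2)"
    by (subst integral_fst'[OF i, symmetric]) simp
qed

text \<open>Expanding the square of the L2 norm of \<open>T f\<close> and integrating in
  \<open>x\<close> first leaves a quadratic form in \<open>f\<close> whose kernel is dominated by
  the convolution kernel \<open>w (y - y')\<close>. Such a form is bounded by the mass
  \<open>S\<close> of \<open>w\<close>. Boundedness and support of \<open>K\<close> serve to justify
  Fubini.\<close>

lemma L2_bound_of_kernel_correlation: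
  fixes K :: "real \<Rightarrow> real \<Rightarrow> complex" and w :: "real \<Rightarrow> real" and A r S :: real
  assumes K: "(\<lambda>(x, y). K x y) \<in> borel_measurable borel"
    and bounded: "\<And>x y. norm (K x y) \<le> A"
    and support: "\<And>x y. \<bar>x\<bar> \<ge> r \<or> \<bar>y\<bar> \<ge> r \<Longrightarrow> K x y = 0"
    and corr: "\<And>y y'. norm (\<integral>x. K x y * cnj (K x y') \<partial>lborel) \<le> w (y - y')"
    and w: "w \<in> borel_measurable borel" "\<And>u. w (- u) = w u" "\<And>u. w u \<ge> 0"
    and S: "(\<integral>\<^sup>+u. ennreal (w u) \<partial>lborel) = ennreal S" "S > 0"
    and f: "f \<in> borel_measurable borel"
  shows "(\<integral>\<^sup>+x. ennreal ((norm (\<integral>y. K x y * f y \<partial>lborel))\<^sup>2) \<partial>lborel)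
    \<le> ennreal S * (\<integral>\<^sup>+y. ennreal ((norm (f y))\<^sup>2) \<partial>lborel)"
proof (cases "(\<integral>\<^sup>+y. ennreal ((norm (f y))\<^sup>2) \<partial>lborel) = \<infinity>")
  \<comment> \<open>Since \<open>S > 0\<close>, the right-hand side is infinite.\<close>
  case True
  then show ?thesis using S by (simp add: ennreal_mult_top)
next
  case False
  \<comment> \<open>Truncation does not change the products \<open>K x y * f y\<close>, and on a
    bounded interval square integrability implies integrability, by t <= 1 + t^2.\<close>
  define F where "F y = (if \<bar>y\<bar> \<le> r then f y else 0)" for y
  have K'[measurable]: "(\<lambda>(x, y). K x y) \<in> borel_measurable (lborel \<Otimes>\<^sub>M lborel)"
    using K by (simp add: lborel_prod)
  note [measurable] = f w(1)
  have [measurable]: "F \<in> borel_measurable borel" unfolding F_def by measurable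
  have A: "A \<ge> 0" using order_trans[OF norm_ge_zero bounded[of 0 0]] .
  have F2: "(\<integral>\<^sup>+y. ennreal ((norm (F y))\<^sup>2) \<partial>lborel) \<le> (\<integral>\<^sup>+y. ennreal ((norm (f y))\<^sup>2) \<partial>lborel)"
    by (intro nn_integral_mono) (auto simp: F_def)
  have int_F: "integrable lborel F"
  proof (rule integrableI_bounded)
    have le: "norm (F y) \<le> indicator {-r..r} y + (norm (F y))\<^sup>2" for y
    proof -
      have "norm (F y) \<le> 1 + (norm (F y))\<^sup>2"
        using sum_squares_bound[of 1 "norm (F y)"] norm_ge_zero[of "F y"] unfolding power_one by linarith
      then show ?thesis by (auto simp: F_def indicator_def abs_le_iff)
    qed
    have "(\<integral>\<^sup>+y. ennreal (norm (F y)) \<partial>lborel) \<le> (\<integral>\<^sup>+y. indicator {-r..r} y + ennreal ((norm (F y))\<^sup>2) \<partial>lborel)"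
      using le by (intro nn_integral_mono)
        (auto simp: ennreal_plus[symmetric] ennreal_indicator[symmetric] simp del: ennreal_plus intro!: ennreal_leI)
    also have "\<dots> = emeasure lborel {-r..r} + (\<integral>\<^sup>+y. ennreal ((norm (F y))\<^sup>2) \<partial>lborel)"
      by (subst nn_integral_add) auto
    also have "\<dots> < \<infinity>"
      using F2 False by (auto simp: less_top[symmetric] emeasure_lborel_Icc_eq top_unique)
    finally show "(\<integral>\<^sup>+y. ennreal (norm (F y)) \<partial>lborel) < \<infinity>" .
  qed simp
  have KF: "K x y * f y = K x y * F y" for x y
    using support[of x y] by (auto simp: F_def)
  define G where "G x y = K x y * F y" for x y
  have G_le: "norm (G x y) \<le> A * norm (F y)" for x y
    unfolding G_def norm_mult by (intro mult_right_mono bounded) auto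
  have [measurable]: "G x \<in> borel_measurable borel" for x
  proof -
    have "(\<lambda>y. K x y * F y) \<in> borel_measurable lborel" by measurable
    then show ?thesis by (simp add: G_def[abs_def])
  qed
  have int_G: "integrable lborel (G x)" for x
    using G_le by (intro Bochner_Integration.integrable_bound[OF integrable_mult_right[OF integrable_norm[OF int_F], of A]])
      (auto simp: G_def A abs_mult)
  define T where "T x = (\<integral>y. G x y \<partial>lborel)" for x
  have [measurable]: "T \<in> borel_measurable borel"
    unfolding T_def G_def by measurable
  have [measurable]: "cnj \<in> borel_measurable borel"
    by (intro borel_measurable_continuous_onI continuous_intros)
  define H where "H x z = G x (fst z) * cnj (G x (snd z))" for x and z :: "real \<times> real"
  let ?P = "lborel \<Otimes>\<^sub>M lborel :: (real \<times> real) measure"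
  interpret P: pair_sigma_finite "lborel :: real measure" ?P
    by unfold_locales
  have sf: "sigma_finite_measure ?P" by unfold_locales
  have [measurable]: "(\<lambda>(x, z). H x z) \<in> borel_measurable (lborel \<Otimes>\<^sub>M ?P)"
    unfolding H_def G_def by measurable
  \<comment> \<open>The squared modulus becomes one integral over pairs \<open>(y, y')\<close>,
    ready for exchange with the integral over \<open>x\<close>.\<close>
  have TH: "T x * cnj (T x) = (\<integral>z. H x z \<partial>?P)" for x
    unfolding T_def integral_cnj[symmetric] H_def
    using lborel_pair.integral_times_integral(2)[OF int_G[of x] integrable_cnj[OF int_G[of x]]]
    by (simp add: case_prod_beta')
  define n1 where "n1 = (\<integral>\<^sup>+y. ennreal (norm (F y)) \<partial>lborel)"
  have n1: "n1 < \<infinity>" using int_F unfolding n1_def integrable_iff_bounded by simp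
  \<comment> \<open>Absolute integrability holds because \<open>x\<close> is confined to a bounded
    interval and \<open>F\<close> is in L1.\<close>
  have int_H: "integrable (lborel \<Otimes>\<^sub>M ?P) (\<lambda>(x, z). H x z)"
  proof (rule integrableI_bounded)
    have le: "norm (H x (y, y')) \<le> A * A * indicator {-r..r} x * norm (F y) * norm (F y')" for x y y'
    proof (cases "\<bar>x\<bar> \<le> r")
      case True
      have "norm (G x y) * norm (G x y') \<le> (A * norm (F y)) * (A * norm (F y'))"
        by (intro mult_mono G_le) (auto simp: A)
      then show ?thesis using True by (simp add: H_def norm_mult abs_le_iff mult_ac)
    next
      case False
      then show ?thesis using support[of x] by (simp add: H_def G_def)
    qed
    have "(\<integral>\<^sup>+z. ennreal (norm (case z of (x, z) \<Rightarrow> H x z)) \<partial>(lborel \<Otimes>\<^sub>M ?P))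
      = (\<integral>\<^sup>+x. \<integral>\<^sup>+y. \<integral>\<^sup>+y'. ennreal (norm (H x (y, y'))) \<partial>lborel \<partial>lborel \<partial>lborel)"
      by (simp add: sigma_finite_measure.nn_integral_fst[OF sf, symmetric] lborel.nn_integral_fst[symmetric])
    also have "\<dots> \<le> (\<integral>\<^sup>+x. \<integral>\<^sup>+y. \<integral>\<^sup>+y'. ennreal (A * A) * indicator {-r..r} x * ennreal (norm (F y)) * ennreal (norm (F y')) \<partial>lborel \<partial>lborel \<partial>lborel)"
      using le A by (intro nn_integral_mono)
        (auto simp: ennreal_mult[symmetric] ennreal_indicator[symmetric] intro!: ennreal_leI)
    also have "\<dots> = ennreal (A * A) * emeasure lborel {-r..r} * n1 * n1"
      by (simp add: nn_integral_cmult nn_integral_multc n1_def[symmetric])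
    also have "\<dots> < \<infinity>"
      using n1 by (simp add: ennreal_mult_less_top emeasure_lborel_Icc_eq)
    finally show "(\<integral>\<^sup>+z. ennreal (norm (case z of (x, z) \<Rightarrow> H x z)) \<partial>(lborel \<Otimes>\<^sub>M ?P)) < \<infinity>" .
  qed measurable
  \<comment> \<open>The inequality 2 u v <= u^2 + v^2 separates the two values of \<open>F\<close>,
    so each resulting term can be integrated against a translate of \<open>w\<close>.\<close>
  have inner: "norm (\<integral>x. H x (y, y') \<partial>lborel) \<le> (norm (F y))\<^sup>2 / 2 * w (y - y') + (norm (F y'))\<^sup>2 / 2 * w (y - y')" for y y'
  proof -
    have "(\<integral>x. H x (y, y') \<partial>lborel) = (\<integral>x. (F y * cnj (F y')) * (K x y * cnj (K x y')) \<partial>lborel)"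
      by (intro Bochner_Integration.integral_cong) (auto simp: H_def G_def)
    also have "\<dots> = (F y * cnj (F y')) * (\<integral>x. K x y * cnj (K x y') \<partial>lborel)"
      by (rule integral_mult_right_zero)
    finally have "norm (\<integral>x. H x (y, y') \<partial>lborel) = norm (F y) * norm (F y') * norm (\<integral>x. K x y * cnj (K x y') \<partial>lborel)"
      by (simp add: norm_mult)
    also have "\<dots> \<le> ((norm (F y))\<^sup>2 / 2 + (norm (F y'))\<^sup>2 / 2) * w (y - y')"
      using sum_squares_bound[of "norm (F y)" "norm (F y')"]
      by (intro mult_mono corr) auto
    finally show ?thesis by (simp add: algebra_simps)
  qed
  have translate: "(\<integral>\<^sup>+y'. ennreal (w (y - y')) \<partial>lborel) = ennreal S" for y
    using nn_integral_real_affine[of "\<lambda>u. ennreal (w u)" "-1" y] S by simp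
  have translate': "(\<integral>\<^sup>+y. ennreal (w (y - y')) \<partial>lborel) = ennreal S" for y'
    using nn_integral_real_affine[of "\<lambda>u. ennreal (w u)" 1 "- y'"] S by simp
  \<comment> \<open>The factor 1/2 stays inside \<open>n2\<close>, so the two equal contributions
    add up to exactly the squared L2 norm of \<open>F\<close>.\<close>
  define n2 where "n2 = (\<integral>\<^sup>+y. ennreal ((norm (F y))\<^sup>2 / 2) \<partial>lborel)"
  have part1: "(\<integral>\<^sup>+y. \<integral>\<^sup>+y'. ennreal ((norm (F y))\<^sup>2 / 2 * w (y - y')) \<partial>lborel \<partial>lborel) = n2 * ennreal S"
  proof -
    have "(\<integral>\<^sup>+y'. ennreal ((norm (F y))\<^sup>2 / 2 * w (y - y')) \<partial>lborel) = ennreal ((norm (F y))\<^sup>2 / 2) * ennreal S" for y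
      unfolding translate[of y, symmetric]
      by (subst nn_integral_cmult[symmetric]) (auto simp: ennreal_mult[symmetric] w)
    then show ?thesis unfolding n2_def by (simp only:) (subst nn_integral_multc, auto)
  qed
  have "(\<integral>\<^sup>+y. \<integral>\<^sup>+y'. ennreal ((norm (F y'))\<^sup>2 / 2 * w (y - y')) \<partial>lborel \<partial>lborel)
      = (\<integral>\<^sup>+y'. \<integral>\<^sup>+y. ennreal ((norm (F y'))\<^sup>2 / 2 * w (y - y')) \<partial>lborel \<partial>lborel)"
    by (subst lborel_pair.Fubini') auto
  also have "\<dots> = n2 * ennreal S"
  proof -
    have "(\<integral>\<^sup>+y. ennreal ((norm (F y'))\<^sup>2 / 2 * w (y - y')) \<partial>lborel) = ennreal ((norm (F y'))\<^sup>2 / 2) * ennreal S" for y'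
      unfolding translate'[of y', symmetric]
      by (subst nn_integral_cmult[symmetric]) (auto simp: ennreal_mult[symmetric] w)
    then show ?thesis unfolding n2_def by (simp only:) (subst nn_integral_multc, auto)
  qed
  finally have part2: "(\<integral>\<^sup>+y. \<integral>\<^sup>+y'. ennreal ((norm (F y'))\<^sup>2 / 2 * w (y - y')) \<partial>lborel \<partial>lborel) = n2 * ennreal S" .
  have int_T: "integrable lborel (\<lambda>x. T x * cnj (T x))"
    using P.integrable_fst'[OF int_H] by (simp add: TH)
  have sq: "T x * cnj (T x) = of_real ((norm (T x))\<^sup>2)" for x
    by (rule complex_norm_square[symmetric])
  have int_T2: "integrable lborel (\<lambda>x. (norm (T x))\<^sup>2)"
    using integrable_norm[OF int_T] by (simp add: norm_mult power2_eq_square)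
  have "(\<integral>\<^sup>+x. ennreal ((norm (T x))\<^sup>2) \<partial>lborel) = ennreal (\<integral>x. (norm (T x))\<^sup>2 \<partial>lborel)"
    by (rule nn_integral_eq_integral[OF int_T2]) simp
  also have "(\<integral>x. (norm (T x))\<^sup>2 \<partial>lborel) = norm (\<integral>x. T x * cnj (T x) \<partial>lborel)"
    unfolding sq integral_complex_of_real norm_of_real by (simp add: abs_of_nonneg)
  also have "(\<integral>x. T x * cnj (T x) \<partial>lborel) = (\<integral>z. \<integral>x. H x z \<partial>lborel \<partial>?P)"
    unfolding TH using P.Fubini_integral[OF int_H] by simp
  also have "ennreal (norm \<dots>) \<le> (\<integral>\<^sup>+z. ennreal (norm (\<integral>x. H x z \<partial>lborel)) \<partial>?P)"
    using P.integrable_snd[OF int_H] by (rule integral_norm_bound_ennreal)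
  also have "\<dots> = (\<integral>\<^sup>+y. \<integral>\<^sup>+y'. ennreal (norm (\<integral>x. H x (y, y') \<partial>lborel)) \<partial>lborel \<partial>lborel)"
    by (subst lborel.nn_integral_fst[symmetric]) auto
  also have "\<dots> \<le> (\<integral>\<^sup>+y. \<integral>\<^sup>+y'. ennreal ((norm (F y))\<^sup>2 / 2 * w (y - y')) + ennreal ((norm (F y'))\<^sup>2 / 2 * w (y - y')) \<partial>lborel \<partial>lborel)"
    using inner w by (intro nn_integral_mono) (simp add: ennreal_plus[symmetric] ennreal_leI del: ennreal_plus)
  also have "\<dots> = n2 * ennreal S + n2 * ennreal S"
    by (simp add: nn_integral_add part1 part2 del: times_divide_eq_left)
  also have "\<dots> = (n2 + n2) * ennreal S" by (simp add: distrib_right)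
  also have "n2 + n2 = (\<integral>\<^sup>+y. ennreal ((norm (F y))\<^sup>2) \<partial>lborel)"
    unfolding n2_def by (subst nn_integral_add[symmetric]) (auto simp: ennreal_plus[symmetric] simp del: ennreal_plus)
  also have "\<dots> * ennreal S \<le> (\<integral>\<^sup>+y. ennreal ((norm (f y))\<^sup>2) \<partial>lborel) * ennreal S"
    using F2 by (rule mult_right_mono) simp
  finally show ?thesis
    unfolding T_def G_def KF by (simp only: mult.commute[of "ennreal S"])
qed

section \<open>Regularity and support of the amplitude\<close>

text \<open>Differentiation is local. This carries the vanishing of the amplitude off its closed
  support over to its derivatives.\<close>

lemma frechet_derivative_eq_0_on_open:
  assumes "open S" "\<And>x. x \<in> S \<Longrightarrow> f x = 0" "z \<in> S"
  shows "frechet_derivative f (at z) v = 0"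
proof -
  have "(f has_derivative (\<lambda>_. 0)) (at z)"
    using assms by (intro has_derivative_transform_within_open[OF has_derivative_const[of 0], of S]) auto
  from fun_cong[OF frechet_derivative_at[OF this], of v] show ?thesis by simp
qed

lemma has_vector_derivative_fst:
  fixes f :: "real \<times> real \<Rightarrow> 'a::real_normed_vector"
  assumes "f differentiable (at (x, y))"
  shows "((\<lambda>t. f (t, y)) has_vector_derivative frechet_derivative f (at (x, y)) (1, 0)) (at x)"
proof -
  let ?D = "frechet_derivative f (at (x, y))"
  have D: "(f has_derivative ?D) (at (x, y))"
    using assms by (rule iffD1[OF frechet_derivative_works])
  have "((\<lambda>t. (t, y)) has_derivative (\<lambda>h. (h, 0))) (at x)"
    by (intro derivative_eq_intros) auto
  from has_derivative_compose[OF this D] have "((\<lambda>t. f (t, y)) has_derivative (\<lambda>h. ?D (h, 0))) (at x)" .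
  moreover have "?D (h, 0) = h *\<^sub>R ?D (1, 0)" for h
    using linear_scale[OF has_derivative_linear[OF D], of h "(1, 0)"]
    unfolding scaleR_Pair real_scaleR_def mult_1_right mult_zero_right .
  then have "(\<lambda>h. ?D (h, 0)) = (\<lambda>h. h *\<^sub>R ?D (1, 0))" by (rule ext)
  ultimately show ?thesis by (simp only: has_vector_derivative_def)
qed

lemma bounded_range_if_compact_support:
  fixes f :: "'a::topological_space \<Rightarrow> 'b::real_normed_vector"
  assumes "continuous_on UNIV f" "compact K" "\<And>z. z \<notin> K \<Longrightarrow> f z = 0"
  obtains B where "\<And>z. norm (f z) \<le> B"
proof -
  have "bounded (f ` K)"
    using assms by (intro compact_imp_bounded compact_continuous_image) (auto intro: continuous_on_subset)
  then obtain B where B: "B > 0" "\<And>z. z \<in> K \<Longrightarrow> norm (f z) \<le> B"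
    by (auto simp: bounded_pos)
  have "norm (f z) \<le> B" for z using B assms(3)[of z] by (cases "z \<in> K") auto
  then show ?thesis by (rule that)
qed

text \<open>This extracts what two integrations by parts in \<open>x\<close> require, with a single
  bound \<open>A\<close> for the amplitude and both derivatives and a single \<open>r\<close> for
  both coordinates.\<close>

lemma smooth_compactly_supported_obtains:
  fixes \<psi> :: "real \<times> real \<Rightarrow> complex"
  assumes sm: "smooth \<psi>" and cs: "compactly_supported \<psi>"
  obtains A r \<psi>' \<psi>'' where "A > 0" "r > 0"
    "\<And>x y. ((\<lambda>t. \<psi> (t, y)) has_vector_derivative \<psi>' (x, y)) (at x)"
    "\<And>x y. ((\<lambda>t. \<psi>' (t, y)) has_vector_derivative \<psi>'' (x, y)) (at x)"
    "continuous_on UNIV \<psi>" "continuous_on UNIV \<psi>''"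
    "\<And>x y. \<bar>x\<bar> \<ge> r \<or> \<bar>y\<bar> \<ge> r \<Longrightarrow> \<psi> (x, y) = 0"
    "\<And>z. norm (\<psi> z) \<le> A" "\<And>z. norm (\<psi>' z) \<le> A" "\<And>z. norm (\<psi>'' z) \<le> A"
proof -
  define \<psi>' where "\<psi>' z = frechet_derivative \<psi> (at z) (1, 0)" for z
  define \<psi>'' where "\<psi>'' z = frechet_derivative \<psi>' (at z) (1, 0)" for z
  \<comment> \<open>Order three is used so that \<open>\<psi>''\<close> is itself differentiable,
    which yields its joint continuity.\<close>
  have "times_differentiable (Suc (Suc (Suc 0))) \<psi>" using sm by (simp add: smooth_def)
  then have d0: "\<And>z. \<psi> differentiable (at z)" and "times_differentiable (Suc (Suc 0)) \<psi>'"
    unfolding times_differentiable.simps(2)[of "Suc (Suc 0)"] \<psi>'_def by blast+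
  then have d1: "\<And>z. \<psi>' differentiable (at z)" and "times_differentiable (Suc 0) \<psi>''"
    unfolding times_differentiable.simps(2)[of "Suc 0"] \<psi>''_def by blast+
  then have d2: "\<And>z. \<psi>'' differentiable (at z)"
    unfolding times_differentiable.simps(2)[of 0] by blast
  have cont: "continuous_on UNIV \<psi>" "continuous_on UNIV \<psi>'" "continuous_on UNIV \<psi>''"
    using d0 d1 d2 by (blast intro: continuous_at_imp_continuous_on differentiable_imp_continuous_within)+
  define K where "K = closure (support_on UNIV \<psi>)"
  have K: "compact K" using cs by (simp add: compactly_supported_def K_def)
  have oK: "open (- K)" unfolding K_def by (intro open_Compl closed_closure)
  have z0: "\<psi> z = 0" if "z \<notin> K" for z
    using that closure_subset[of "support_on UNIV \<psi>"] by (auto simp: K_def support_on_def)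
  have z1: "\<psi>' z = 0" if "z \<notin> K" for z
    unfolding \<psi>'_def by (rule frechet_derivative_eq_0_on_open[OF oK]) (use z0 that in auto)
  have z2: "\<psi>'' z = 0" if "z \<notin> K" for z
    unfolding \<psi>''_def by (rule frechet_derivative_eq_0_on_open[OF oK]) (use z1 that in auto)
  obtain B0 where B0: "\<And>z. norm (\<psi> z) \<le> B0"
    using bounded_range_if_compact_support[OF cont(1) K z0] by blast
  obtain B1 where B1: "\<And>z. norm (\<psi>' z) \<le> B1"
    using bounded_range_if_compact_support[OF cont(2) K z1] by blast
  obtain B2 where B2: "\<And>z. norm (\<psi>'' z) \<le> B2"
    using bounded_range_if_compact_support[OF cont(3) K z2] by blast
  obtain r0 where r0: "\<And>z. z \<in> K \<Longrightarrow> norm z \<le> r0"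
    using compact_imp_bounded[OF K] unfolding bounded_iff by blast
  \<comment> \<open>The added 1 puts every point with a coordinate of modulus at least
    \<open>r\<close>, equality included, outside \<open>K\<close>.\<close>
  define r where "r = \<bar>r0\<bar> + 1"
  have out: "(x, y) \<notin> K" if "\<bar>x\<bar> \<ge> r \<or> \<bar>y\<bar> \<ge> r" for x y
  proof
    assume "(x, y) \<in> K"
    then have "norm (x, y) \<le> r0" by (rule r0)
    then show False
      using that norm_fst_le[of x y] norm_snd_le[of y x] unfolding r_def real_norm_def by linarith
  qed
  \<comment> \<open>The 1 keeps \<open>A\<close> positive even when \<open>\<psi>\<close> is
    identically 0.\<close>
  define A where "A = max 1 (max B0 (max B1 B2))"
  show ?thesis
  proof (rule that[of A r \<psi>' \<psi>''])
    show "((\<lambda>t. \<psi> (t, y)) has_vector_derivative \<psi>' (x, y)) (at x)" for x y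
      unfolding \<psi>'_def by (rule has_vector_derivative_fst[OF d0])
    show "((\<lambda>t. \<psi>' (t, y)) has_vector_derivative \<psi>'' (x, y)) (at x)" for x y
      unfolding \<psi>''_def by (rule has_vector_derivative_fst[OF d1])
    show "norm (\<psi> z) \<le> A" "norm (\<psi>' z) \<le> A" "norm (\<psi>'' z) \<le> A" for z
      using B0[of z] B1[of z] B2[of z] by (auto simp: A_def)
    show "\<psi> (x, y) = 0" if "\<bar>x\<bar> \<ge> r \<or> \<bar>y\<bar> \<ge> r" for x y
      using out[OF that] z0 by blast
  qed (simp_all add: A_def r_def cont)
qed

section \<open>The oscillatory kernel and its correlations\<close>

definition osc_kernel :: "(real \<Rightarrow> real \<Rightarrow> real) \<Rightarrow> (real \<times> real \<Rightarrow> complex) \<Rightarrow> real \<Rightarrow> real \<Rightarrow> real \<Rightarrow> complex"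
  where "osc_kernel Q \<psi> l x y = exp (\<i> * complex_of_real (l * Q x y)) * \<psi> (x, y)"

lemma norm_osc_kernel: "norm (osc_kernel Q \<psi> l x y) = norm (\<psi> (x, y))"
  by (simp add: osc_kernel_def norm_mult)

lemma continuous_osc_kernel:
  assumes "continuous_on UNIV \<psi>"
  shows "continuous_on UNIV (\<lambda>(x, y). osc_kernel (Qphase a b c d e) \<psi> l x y)"
  unfolding osc_kernel_def Qphase_def case_prod_beta' prod.collapse
  by (intro continuous_intros assms)

text \<open>In the difference of the phases at \<open>y\<close> and \<open>y'\<close> the terms in
  \<open>x\<close> alone cancel and the terms in \<open>y\<close> alone give a unimodular constant.
  Only the mixed term survives, so the phase is linear in \<open>x\<close> with frequency l b (y -
  y').\<close>

lemma Qphase_correlation_bound: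
  fixes \<psi> \<psi>' \<psi>'' :: "real \<times> real \<Rightarrow> complex"
  assumes A: "A > 0" and r: "r > 0"
    and d1: "\<And>x y. ((\<lambda>t. \<psi> (t, y)) has_vector_derivative \<psi>' (x, y)) (at x)"
    and d2: "\<And>x y. ((\<lambda>t. \<psi>' (t, y)) has_vector_derivative \<psi>'' (x, y)) (at x)"
    and cont: "continuous_on UNIV \<psi>''"
    and zero: "\<And>x y. \<bar>x\<bar> \<ge> r \<or> \<bar>y\<bar> \<ge> r \<Longrightarrow> \<psi> (x, y) = 0"
    and bd: "\<And>z. norm (\<psi> z) \<le> A" "\<And>z. norm (\<psi>' z) \<le> A" "\<And>z. norm (\<psi>'' z) \<le> A"
  shows "norm (\<integral>x. osc_kernel (Qphase a b c d e) \<psi> l x y * cnj (osc_kernel (Qphase a b c d e) \<psi> l x y') \<partial>lborel)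
     \<le> 10 * r * A\<^sup>2 / (1 + (l * b * (y - y'))\<^sup>2)"
proof -
  define g where "g x = \<psi> (x, y) * cnj (\<psi> (x, y'))" for x
  define g' where "g' x = \<psi> (x, y) * cnj (\<psi>' (x, y')) + \<psi>' (x, y) * cnj (\<psi> (x, y'))" for x
  define g'' where "g'' x = \<psi> (x, y) * cnj (\<psi>'' (x, y')) + \<psi>' (x, y) * cnj (\<psi>' (x, y'))
    + (\<psi>' (x, y) * cnj (\<psi>' (x, y')) + \<psi>'' (x, y) * cnj (\<psi> (x, y')))" for x
  define m where "m = l * b * (y - y')"
  define \<alpha> where "\<alpha> = l * (c * y\<^sup>2 + e * y - c * y'\<^sup>2 - e * y')"
  have eq: "osc_kernel (Qphase a b c d e) \<psi> l x y * cnj (osc_kernel (Qphase a b c d e) \<psi> l x y')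
      = exp (\<i> * of_real \<alpha>) * (exp (\<i> * of_real (m * x)) * g x)" for x
  proof -
    have "exp (\<i> * of_real (l * Qphase a b c d e x y)) * cnj (exp (\<i> * of_real (l * Qphase a b c d e x y')))
      = exp (\<i> * of_real \<alpha>) * exp (\<i> * of_real (m * x))"
      unfolding exp_cnj exp_add[symmetric]
      by (rule arg_cong[where f = exp]) (simp add: \<alpha>_def m_def Qphase_def algebra_simps)
    then show ?thesis by (simp add: osc_kernel_def g_def mult_ac)
  qed
  have g1: "(g has_vector_derivative g' x) (at x)" for x
    unfolding g_def g'_def by (intro has_vector_derivative_mult has_vector_derivative_cnj d1)
  have g2: "(g' has_vector_derivative g'' x) (at x)" for x
    unfolding g'_def g''_def
    by (intro has_vector_derivative_mult has_vector_derivative_add has_vector_derivative_cnj d1 d2)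
  have c: "continuous_on UNIV (\<lambda>x. \<psi> (x, y))" "continuous_on UNIV (\<lambda>x. \<psi>' (x, y))"
      "continuous_on UNIV (\<lambda>x. \<psi>'' (x, y))" for y
  proof -
    show "continuous_on UNIV (\<lambda>x. \<psi> (x, y))" "continuous_on UNIV (\<lambda>x. \<psi>' (x, y))"
      using d1 d2 by (blast intro: continuous_at_imp_continuous_on has_vector_derivative_continuous)+
    show "continuous_on UNIV (\<lambda>x. \<psi>'' (x, y))"
      by (rule continuous_on_compose2[OF cont]) (auto intro!: continuous_intros)
  qed
  have prod: "norm (u * cnj v) \<le> A\<^sup>2" if "norm u \<le> A" "norm v \<le> A" for u v :: complex
    using mult_mono[OF that] A by (simp add: norm_mult power2_eq_square)
  \<comment> \<open>\<open>g''\<close> is a sum of four products, each at most A^2; together with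
    the bound for \<open>g\<close> this gives 2 * (1 + 4) = 10 in the conclusion.\<close>
  have "norm (\<integral>x. exp (\<i> * of_real (m * x)) * g x \<partial>lborel) \<le> 2 * r * (A\<^sup>2 + 4 * A\<^sup>2) / (1 + m\<^sup>2)"
  proof (rule oscillatory_integral_bound[of g g' g'', OF g1 g2])
    show "continuous_on UNIV g''" unfolding g''_def by (intro continuous_intros c)
    show "norm (g'' x) \<le> 4 * A\<^sup>2" for x
    proof -
      have tri: "norm (u + v + (w + z)) \<le> norm u + norm v + (norm w + norm z)" for u v w z :: complex
        by (intro norm_triangle_mono order_refl)
      show ?thesis
        unfolding g''_def using tri[of "\<psi> (x, y) * cnj (\<psi>'' (x, y'))" "\<psi>' (x, y) * cnj (\<psi>' (x, y'))"
            "\<psi>' (x, y) * cnj (\<psi>' (x, y'))" "\<psi>'' (x, y) * cnj (\<psi> (x, y'))"]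
          prod[OF bd(1) bd(3), of "(x, y)" "(x, y')"] prod[OF bd(2) bd(2), of "(x, y)" "(x, y')"]
          prod[OF bd(3) bd(1), of "(x, y)" "(x, y')"] by linarith
    qed
    show "norm (g x) \<le> A\<^sup>2" for x unfolding g_def by (intro prod bd)
    show "g x = 0" "g' x = 0" if "\<bar>x\<bar> \<ge> r" for x
      using zero[of x] that by (simp_all add: g_def g'_def)
  qed (use r in simp)
  then show ?thesis
    unfolding eq by (simp add: norm_mult m_def)
qed

section \<open>The endpoint bounds combined\<close>

lemma Lp_space_lebesgue_bound:
  fixes h :: "real \<Rightarrow> complex" and q X :: real
  assumes h: "h \<in> borel_measurable borel" and q: "q > 0" and X: "X \<ge> 0"
    and le: "(\<integral>\<^sup>+x. ennreal (norm (h x) powr q) \<partial>lborel) \<le> ennreal X"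
  shows "h \<in> Lp_space (ennreal q) lebesgue" "Lp_norm (ennreal q) lebesgue h \<le> X powr (1 / q)"
proof -
  have m: "(\<lambda>x. norm (h x) powr q) \<in> borel_measurable lborel" using h by measurable
  have "integrable lborel (\<lambda>x. norm (h x) powr q)"
    using m le by (intro integrableI_bounded) (auto intro: le_less_trans)
  then have i: "integrable lebesgue (\<lambda>x. norm (h x) powr q)"
    using integrable_completion[OF m] by simp
  then show "h \<in> Lp_space (ennreal q) lebesgue"
    using q h by (auto simp: Lp_space_def intro: measurable_completion)
  have "ennreal (\<integral>x. norm (h x) powr q \<partial>lebesgue) = (\<integral>\<^sup>+x. ennreal (norm (h x) powr q) \<partial>lebesgue)"
    by (rule nn_integral_eq_integral[OF i, symmetric]) simp
  also have "\<dots> \<le> ennreal X" using le by (simp add: nn_integral_completion)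
  finally have "(\<integral>x. norm (h x) powr q \<partial>lebesgue) \<le> X" using X by simp
  then have "(\<integral>x. norm (h x) powr q \<partial>lebesgue) powr (1 / q) \<le> X powr (1 / q)"
    using q by (intro powr_mono2) auto
  then show "Lp_norm (ennreal q) lebesgue h \<le> X powr (1 / q)"
    using q by (simp add: Lp_norm_def)
qed

text \<open>The product-measure arguments run over \<open>lborel\<close>, whereas members of
  \<open>Lp_space\<close> are only Lebesgue measurable. A Borel representative is assembled from
  those of the real and imaginary parts.\<close>

lemma lebesgue_AE_eq_borel_complex:
  fixes f :: "'a::euclidean_space \<Rightarrow> complex"
  assumes "f \<in> borel_measurable lebesgue"
  obtains f' where "f' \<in> borel_measurable borel" "AE x in lebesgue. f x = f' x"
proof -
  have "(\<lambda>x. Re (f x)) \<in> borel_measurable lebesgue" "(\<lambda>x. Im (f x)) \<in> borel_measurable lebesgue"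
    using assms by measurable
  from this[THEN completion_ex_borel_measurable_real] obtain u v where
    uv: "u \<in> borel_measurable lborel" "AE x in lborel. Re (f x) = u x"
        "v \<in> borel_measurable lborel" "AE x in lborel. Im (f x) = v x" by blast
  have [measurable]: "u \<in> borel_measurable borel" "v \<in> borel_measurable borel" using uv by auto
  show ?thesis
  proof (rule that[of "\<lambda>x. of_real (u x) + \<i> * of_real (v x)"])
    show "AE x in lebesgue. f x = of_real (u x) + \<i> * of_real (v x)"
      using AE_completion[OF uv(2)] AE_completion[OF uv(4)]
      by eventually_elim (simp add: complex_eq_iff)
  qed measurable
qed

section \<open>Constants and conjugate exponents\<close>

text \<open>The factor q (q - 1) / 2 is at most exp q, whose q-th root is e. Hence one constant
  \<open>D\<close>, independent of the exponents, absorbs the loss of real interpolation.\<close>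

lemma interpolated_constant_bound:
  fixes q C A l n D :: real
  assumes q: "q \<ge> 2" and A: "A > 0" and C: "C > 0" and l: "l > 0" and n: "n \<ge> 0"
    and D: "D = exp 1 * max A (sqrt C)" and p: "1 / p = 1 - 1 / q"
  shows "(q * (q - 1) / 2 * (C / l) * A powr (q - 2) * n powr (q - 1)) powr (1 / q)
     \<le> D powr (2 / p - 1) * (D / sqrt l) powr (2 * (1 - 1 / p)) * n powr (1 / p)"
proof -
  define m where "m = max A (sqrt C)"
  have m: "m > 0" "A \<le> m" "sqrt C \<le> m" using A by (auto simp: m_def)
  have "q * (q - 1) / 2 \<le> exp q"
    using exp_lower_Taylor_quadratic[of q] q by (simp add: power2_eq_square algebra_simps)
  moreover have "C / l \<le> (m / sqrt l) powr 2"
    using m l C power_mono[OF m(3), of 2] by (simp add: powr_numeral power_divide divide_right_mono)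
  moreover have "A powr (q - 2) \<le> m powr (q - 2)"
    using q A m by (intro powr_mono2) auto
  ultimately have "q * (q - 1) / 2 * (C / l) * A powr (q - 2) * n powr (q - 1)
      \<le> exp q * (m / sqrt l) powr 2 * m powr (q - 2) * n powr (q - 1)"
    using q C l by (intro mult_mono) auto
  then have "(q * (q - 1) / 2 * (C / l) * A powr (q - 2) * n powr (q - 1)) powr (1 / q)
      \<le> (exp q * (m / sqrt l) powr 2 * m powr (q - 2) * n powr (q - 1)) powr (1 / q)"
    using q C l by (intro powr_mono2) auto
  also have "\<dots> = exp 1 * (m / sqrt l) powr (2 / q) * m powr ((q - 2) / q) * n powr ((q - 1) / q)"
    using q m l by (simp add: powr_mult powr_powr exp_powr_real del: powr_numeral)
  \<comment> \<open>The exponents 2 / q and (q - 2) / q add up to 1, so the single factor e can be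
    shared out to turn both occurrences of \<open>m\<close> into \<open>D\<close>.\<close>
  also have "exp 1 = exp 1 powr (2 / q) * exp 1 powr ((q - 2) / (q::real))"
    using q by (simp add: powr_add[symmetric] add_divide_distrib[symmetric])
  also have "exp 1 powr (2 / q) * exp 1 powr ((q - 2) / q) * (m / sqrt l) powr (2 / q) * m powr ((q - 2) / q) * n powr ((q - 1) / q)
     = D powr ((q - 2) / q) * (D / sqrt l) powr (2 / q) * n powr ((q - 1) / q)"
    using m l by (simp add: D m_def[symmetric] powr_mult powr_divide)
  also have "(q - 2) / q = 2 / p - 1"
  proof -
    have "2 / p = 2 * (1 - 1 / q)" by (simp add: p[symmetric])
    then show ?thesis using q by (simp add: diff_divide_distrib)
  qed
  also have "2 / q = 2 * (1 - 1 / p)" using p by simp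
  also have "(q - 1) / q = 1 / p" using p q by (simp add: diff_divide_distrib)
  finally show ?thesis .
qed

text \<open>In \<open>ennreal\<close> the value 1 / 0 is infinite, which excludes
  \<open>r = 0\<close>, and an infinite \<open>r\<close> contributes 0, which forces
  \<open>p = 1\<close>. A finite positive \<open>r\<close> reduces to real arithmetic.\<close>

lemma ennreal_conjugate_exponent:
  fixes p :: real
  assumes "p \<ge> 1" "1 / ennreal p + 1 / r = 1"
  shows "r = (if p = 1 then \<infinity> else ennreal (p / (p - 1)))"
proof -
  have p: "1 / ennreal p = ennreal (1 / p)"
    using assms(1) by (metis divide_ennreal ennreal_1 less_le_trans zero_le_one zero_less_one)
  show ?thesis
  proof (cases r)
    case (real s)
    show ?thesis
    proof (cases "s = 0")
      case True
      then show ?thesis using assms(2) real by simp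
    next
      case False
      then have s: "s > 0" using real by simp
      then have "1 / r = ennreal (1 / s)"
        using real by (metis divide_ennreal ennreal_1 zero_le_one)
      then have "ennreal (1 / p + 1 / s) = ennreal 1"
        using assms s by (simp add: p)
      then have e: "1 / p + 1 / s = 1"
        using assms(1) s by (subst (asm) ennreal_inj) auto
      then have "p \<noteq> 1" using s by auto
      moreover have "s = p / (p - 1)"
        using e s assms(1) \<open>p \<noteq> 1\<close> by (simp add: field_simps)
      ultimately show ?thesis using real by simp
    qed
  next
    case top
    then have "ennreal (1 / p) = ennreal 1" using assms(2) by (simp add: p)
    then have "1 / p = 1" using assms(1) by (subst (asm) ennreal_inj) auto
    then show ?thesis using top by simp
  qed
qed

section \<open>The kernel operator at all exponents\<close>

text \<open>This verifies the abstract hypotheses of \<open>interpolation_L1_L2\<close> for an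
  integral operator with a bounded kernel supported in a strip in \<open>y\<close>.\<close>

lemma kernel_operator_bounds:
  fixes K :: "real \<Rightarrow> real \<Rightarrow> complex" and A B r n p q :: real
  defines "T \<equiv> \<lambda>f x. \<integral>y. K x y * f y \<partial>lborel"
  assumes K: "(\<lambda>(x, y). K x y) \<in> borel_measurable borel"
    and K_zero: "\<And>x y. \<bar>y\<bar> \<ge> r \<Longrightarrow> K x y = 0"
    and A: "A > 0" "\<And>x y. norm (K x y) \<le> A" and B: "B \<ge> 0"
    and L2: "\<And>g. g \<in> borel_measurable borel \<Longrightarrow>
      (\<integral>\<^sup>+x. ennreal ((norm (T g x))\<^sup>2) \<partial>lborel) \<le> ennreal B * (\<integral>\<^sup>+y. ennreal ((norm (g y))\<^sup>2) \<partial>lborel)"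
    and f: "f \<in> borel_measurable borel"
  shows kernel_measurable: "T f \<in> borel_measurable borel"
    and kernel_bound_L1: "ennreal (norm (T f x)) \<le> ennreal A * (\<integral>\<^sup>+y. ennreal (norm (f y)) \<partial>lborel)"
    and kernel_bound_Lp: "q \<ge> 2 \<Longrightarrow> p = q / (q - 1) \<Longrightarrow> n \<ge> 0 \<Longrightarrow>
      (\<integral>\<^sup>+y. ennreal (norm (f y) powr p) \<partial>lborel) = ennreal n \<Longrightarrow>
      (\<integral>\<^sup>+x. ennreal (norm (T f x) powr q) \<partial>lborel)
        \<le> ennreal (q * (q - 1) / 2 * B * A powr (q - 2) * n powr (q - 1))"
proof -
  have [measurable]: "(\<lambda>(x, y). K x y) \<in> borel_measurable (lborel \<Otimes>\<^sub>M lborel)"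
    using K by (simp add: lborel_prod)
  have K_le: "norm (K x y) \<le> A" for x y by (rule A)
  have meas: "T g \<in> borel_measurable lborel" if [measurable]: "g \<in> borel_measurable lborel" for g
    unfolding T_def by measurable
  then show "T f \<in> borel_measurable borel" using f by simp
  have bound1: "ennreal (norm (T g x)) \<le> ennreal A * (\<integral>\<^sup>+y. ennreal (norm (g y)) \<partial>lborel)"
    if [measurable]: "g \<in> borel_measurable lborel" for g x
  proof (cases "integrable lborel (\<lambda>y. K x y * g y)")
    case True
    have "ennreal (norm (T g x)) \<le> (\<integral>\<^sup>+y. ennreal (norm (K x y * g y)) \<partial>lborel)"
      unfolding T_def by (rule integral_norm_bound_ennreal[OF True])
    also have "\<dots> \<le> (\<integral>\<^sup>+y. ennreal A * ennreal (norm (g y)) \<partial>lborel)"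
      using A K_le by (intro nn_integral_mono)
        (auto simp: norm_mult ennreal_mult[symmetric] intro!: ennreal_leI mult_right_mono)
    also have "\<dots> = ennreal A * (\<integral>\<^sup>+y. ennreal (norm (g y)) \<partial>lborel)"
      by (rule nn_integral_cmult) measurable
    finally show ?thesis .
  next
    \<comment> \<open>A divergent Bochner integral has value 0, so the bound holds for every
      measurable \<open>g\<close>.\<close>
    case False
    then show ?thesis by (simp add: T_def not_integrable_integral_eq)
  qed
  show "ennreal (norm (T f x)) \<le> ennreal A * (\<integral>\<^sup>+y. ennreal (norm (f y)) \<partial>lborel)"
    using f by (intro bound1) simp
  have int1: "integrable lborel (\<lambda>y. K x y * g y)"
    if [measurable]: "g \<in> borel_measurable lborel" and "(\<integral>\<^sup>+y. ennreal (norm (g y)) \<partial>lborel) < \<infinity>" for g x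
  proof -
    have "integrable lborel g" using that by (intro integrableI_bounded)
    then have "integrable lborel (\<lambda>y. A * norm (g y))" by (intro integrable_mult_right integrable_norm)
    then show ?thesis
      by (rule Bochner_Integration.integrable_bound)
        (use A K_le in \<open>auto simp: norm_mult abs_mult intro!: mult_right_mono\<close>)
  qed
  \<comment> \<open>The kernel confines \<open>y\<close> to a bounded interval, where t <= 1 + t^2
    again passes from L2 to L1.\<close>
  have int2: "integrable lborel (\<lambda>y. K x y * g y)"
    if [measurable]: "g \<in> borel_measurable lborel" and g2: "(\<integral>\<^sup>+y. ennreal ((norm (g y))\<^sup>2) \<partial>lborel) < \<infinity>" for g x
  proof -
    have "integrable lborel (\<lambda>y. (norm (g y))\<^sup>2)" using g2 by (intro integrableI_bounded) auto
    then have "integrable lborel (\<lambda>y. A * (indicator {-r..r} y + (norm (g y))\<^sup>2))"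
      by (intro integrable_mult_right Bochner_Integration.integrable_add integrable_real_indicator)
        (auto simp: emeasure_lborel_Icc_eq)
    then show ?thesis
    proof (rule Bochner_Integration.integrable_bound)
      have "norm (K x y * g y) \<le> A * (indicator {-r..r} y + (norm (g y))\<^sup>2)" for y
      proof (cases "\<bar>y\<bar> \<ge> r")
        case False
        have "norm (g y) \<le> 1 + (norm (g y))\<^sup>2"
          using sum_squares_bound[of 1 "norm (g y)"] norm_ge_zero[of "g y"] unfolding power_one by linarith
        then have "norm (K x y) * norm (g y) \<le> A * (1 + (norm (g y))\<^sup>2)"
          using K_le A by (intro mult_mono) auto
        moreover have "y \<in> {-r..r}" using False by auto
        ultimately show ?thesis by (simp add: norm_mult)
      qed (use K_zero A in auto)
      then show "AE y in lborel. norm (K x y * g y) \<le> norm (A * (indicator {-r..r} y + (norm (g y))\<^sup>2))"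
        using A by (intro AE_I2) (simp add: abs_of_nonneg)
    qed measurable
  qed
  show "(\<integral>\<^sup>+x. ennreal (norm (T f x) powr q) \<partial>lborel)
        \<le> ennreal (q * (q - 1) / 2 * B * A powr (q - 2) * n powr (q - 1))"
    if q: "q \<ge> 2" and p: "p = q / (q - 1)" and n: "n \<ge> 0"
      and fn: "(\<integral>\<^sup>+y. ennreal (norm (f y) powr p) \<partial>lborel) = ennreal n"
  proof (cases "q = 2")
    \<comment> \<open>The interpolation needs \<open>q > 2\<close>; at \<open>q = 2\<close> the
      claimed constant reduces to \<open>B * n\<close>, which is the L2 hypothesis.\<close>
    case True
    then have "(\<integral>\<^sup>+y. ennreal ((norm (f y))\<^sup>2) \<partial>lborel) = ennreal n"
      using fn by (simp add: p)
    then show ?thesis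
      using L2[OF f] True n B A by (simp add: ennreal_mult[symmetric])
  next
    case False
    then have q: "q > 2" using q by simp
    show ?thesis
    proof (rule interpolation_L1_L2[OF _ _ q p A(1) B n meas _ bound1 _ _ fn])
      show "norm (T (\<lambda>y. g y + h y) x) \<le> norm (T g x) + norm (T h x)"
        if "g \<in> borel_measurable lborel" "h \<in> borel_measurable lborel"
          "(\<integral>\<^sup>+y. ennreal (norm (g y)) \<partial>lborel) < \<infinity>" "(\<integral>\<^sup>+y. ennreal ((norm (h y))\<^sup>2) \<partial>lborel) < \<infinity>" for g h x
        unfolding T_def distrib_left Bochner_Integration.integral_add[OF int1[OF that(1,3)] int2[OF that(2,4)]]
        by (rule norm_triangle_ineq)
    qed (use f L2 in \<open>auto intro: lborel.sigma_finite_measure_axioms\<close>)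
  qed
qed

theorem theorem2p1:
  fixes a b c d e :: real
    and \<psi> :: "real \<times> real \<Rightarrow> complex"
  assumes "b \<noteq> 0"
    and "smooth \<psi>"
    and "compactly_supported \<psi>"
  shows "\<exists>C\<^sub>1 :: real. C\<^sub>1 > 0 \<and>
    (\<forall>(p :: real) (p\<^sub>1 :: ennreal) (l :: real) (f :: real \<Rightarrow> complex).
       1 \<le> p \<longrightarrow> p \<le> 2 \<longrightarrow> 1 / ennreal p + 1 / p\<^sub>1 = 1 \<longrightarrow> l > 0 \<longrightarrow>
       f \<in> Lp_space (ennreal p) lebesgue \<longrightarrow>
       osc_op (Qphase a b c d e) \<psi> l f \<in> Lp_space p\<^sub>1 lebesgue \<and>
       Lp_norm p\<^sub>1 lebesgue (osc_op (Qphase a b c d e) \<psi> l f)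
         \<le> C\<^sub>1 powr (2 / p - 1) * (C\<^sub>1 / sqrt l) powr (2 * (1 - 1 / p))
            * Lp_norm (ennreal p) lebesgue f)"
proof -
  obtain A r \<psi>' \<psi>'' where A: "A > 0" and r: "r > 0"
    and d1: "\<And>x y. ((\<lambda>t. \<psi> (t, y)) has_vector_derivative \<psi>' (x, y)) (at x)"
    and d2: "\<And>x y. ((\<lambda>t. \<psi>' (t, y)) has_vector_derivative \<psi>'' (x, y)) (at x)"
    and cont: "continuous_on UNIV \<psi>" "continuous_on UNIV \<psi>''"
    and zero: "\<And>x y. \<bar>x\<bar> \<ge> r \<or> \<bar>y\<bar> \<ge> r \<Longrightarrow> \<psi> (x, y) = 0"
    and bd: "\<And>z. norm (\<psi> z) \<le> A" "\<And>z. norm (\<psi>' z) \<le> A" "\<And>z. norm (\<psi>'' z) \<le> A"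
    by (rule smooth_compactly_supported_obtains[OF assms(2,3)]) (rule that)
  define K where "K = osc_kernel (Qphase a b c d e) \<psi>"
  define T where "T l f x = (\<integral>y. K l x y * f y \<partial>lborel)" for l f x
  \<comment> \<open>The integral of the majorant 10 r A^2 / (1 + (l b u)^2) over \<open>u\<close> is
    exactly \<open>C / l\<close>; this is the source of the decay in \<open>l\<close>.\<close>
  define C where "C = 10 * r * A\<^sup>2 * pi / \<bar>b\<bar>"
  have C: "C > 0" using A r assms(1) by (simp add: C_def)
  have L2: "(\<integral>\<^sup>+x. ennreal ((norm (T l f x))\<^sup>2) \<partial>lborel) \<le> ennreal (C / l) * (\<integral>\<^sup>+y. ennreal ((norm (f y))\<^sup>2) \<partial>lborel)"
    if l: "l > 0" and f: "f \<in> borel_measurable borel" for l f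
    unfolding T_def K_def
  proof (rule L2_bound_of_kernel_correlation[where A = A and r = r and w = "\<lambda>u. 10 * r * A\<^sup>2 / (1 + (l * b * u)\<^sup>2)", OF _ _ _ _ _ _ _ _ _ f])
    show "(\<lambda>(x, y). osc_kernel (Qphase a b c d e) \<psi> l x y) \<in> borel_measurable borel"
      by (intro borel_measurable_continuous_onI continuous_osc_kernel cont)
    show "norm (\<integral>x. osc_kernel (Qphase a b c d e) \<psi> l x y * cnj (osc_kernel (Qphase a b c d e) \<psi> l x y') \<partial>lborel)
      \<le> 10 * r * A\<^sup>2 / (1 + (l * b * (y - y'))\<^sup>2)" for y y'
      by (rule Qphase_correlation_bound[OF A r d1 d2 cont(2) zero bd])
    show "(\<integral>\<^sup>+u. ennreal (10 * r * A\<^sup>2 / (1 + (l * b * u)\<^sup>2)) \<partial>lborel) = ennreal (C / l)"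
      using assms(1) l r by (subst nn_integral_inverse_1_plus_scaled_square) (auto simp: C_def abs_mult mult.commute)
    show "norm (osc_kernel (Qphase a b c d e) \<psi> l x y) \<le> A" for x y
      unfolding norm_osc_kernel by (rule bd(1))
    show "osc_kernel (Qphase a b c d e) \<psi> l x y = 0" if "\<bar>x\<bar> \<ge> r \<or> \<bar>y\<bar> \<ge> r" for x y
      using zero[OF that] by (simp add: osc_kernel_def)
  qed (use C l r in simp_all)
  have K_borel: "(\<lambda>(x, y). K l x y) \<in> borel_measurable borel" for l
    unfolding K_def by (intro borel_measurable_continuous_onI continuous_osc_kernel cont)
  have K_zero: "\<bar>y\<bar> \<ge> r \<Longrightarrow> K l x y = 0" for l x y
    using zero by (simp add: K_def osc_kernel_def)
  have K_le: "norm (K l x y) \<le> A" for l x y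
    using bd(1) by (simp add: K_def norm_osc_kernel)
  \<comment> \<open>The final constant. It is the one of \<open>interpolated_constant_bound\<close>,
    and it also dominates \<open>A\<close>, as the endpoint \<open>p = 1\<close> requires.\<close>
  define D where "D = exp 1 * max A (sqrt C)"
  have D: "D > 0" using A by (simp add: D_def less_max_iff_disj)
  have "1 * A \<le> exp 1 * max A (sqrt C)" using A by (intro mult_mono) auto
  then have AD: "A \<le> D" by (simp add: D_def)
  have main: "osc_op (Qphase a b c d e) \<psi> l f \<in> Lp_space p\<^sub>1 lebesgue \<and>
       Lp_norm p\<^sub>1 lebesgue (osc_op (Qphase a b c d e) \<psi> l f)
         \<le> D powr (2 / p - 1) * (D / sqrt l) powr (2 * (1 - 1 / p)) * Lp_norm (ennreal p) lebesgue f"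
    if p: "1 \<le> p" "p \<le> 2" and p1: "1 / ennreal p + 1 / p\<^sub>1 = 1" and l: "l > 0"
      and f: "f \<in> Lp_space (ennreal p) lebesgue" for p l :: real and p\<^sub>1 f
  proof -
    have fm [measurable]: "f \<in> borel_measurable lebesgue" and fi: "integrable lebesgue (\<lambda>x. norm (f x) powr p)"
      using f p by (auto simp: Lp_space_def)
    obtain f' where f' [measurable]: "f' \<in> borel_measurable borel" and ff': "AE x in lebesgue. f x = f' x"
      using lebesgue_AE_eq_borel_complex[OF fm] .
    \<comment> \<open>Changing \<open>f\<close> on a null set leaves the integral over
      \<open>y\<close> unchanged for every \<open>x\<close>, so this is a pointwise identity and
      also makes the left-hand side Borel.\<close>
    have osc: "osc_op (Qphase a b c d e) \<psi> l f = T l f'"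
    proof
      fix x
      have Km: "K l x \<in> borel_measurable lborel"
      proof -
        have "continuous_on UNIV (\<lambda>y. (\<lambda>(x, y). K l x y) (x, y))"
          unfolding K_def by (rule continuous_on_compose2[OF continuous_osc_kernel[OF cont(1)]]) (auto intro!: continuous_intros)
        then show ?thesis by (simp add: borel_measurable_continuous_onI)
      qed
      note [measurable] = measurable_completion[OF Km] measurable_completion[of f' lborel borel]
      have "osc_op (Qphase a b c d e) \<psi> l f x = (\<integral>y. K l x y * f y \<partial>lebesgue)"
        by (simp add: osc_op_def K_def osc_kernel_def)
      also have "\<dots> = (\<integral>y. K l x y * f' y \<partial>lebesgue)"
        using ff' f' by (intro integral_cong_AE) auto
      also have "\<dots> = T l f' x"
        unfolding T_def using Km f' by (intro integral_completion) auto
      finally show "osc_op (Qphase a b c d e) \<psi> l f x = T l f' x" .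
    qed
    define n where "n = (\<integral>x. norm (f x) powr p \<partial>lebesgue)"
    have n: "n \<ge> 0" by (simp add: n_def)
    have norm_f: "Lp_norm (ennreal p) lebesgue f = n powr (1 / p)"
      using p by (simp add: Lp_norm_def n_def)
    have "(\<integral>\<^sup>+y. ennreal (norm (f' y) powr p) \<partial>lborel) = (\<integral>\<^sup>+y. ennreal (norm (f' y) powr p) \<partial>lebesgue)"
      by (rule nn_integral_completion[symmetric])
    also have "\<dots> = (\<integral>\<^sup>+y. ennreal (norm (f y) powr p) \<partial>lebesgue)"
      using ff' by (intro nn_integral_cong_AE) auto
    also have "\<dots> = ennreal n"
      unfolding n_def by (rule nn_integral_eq_integral[OF fi]) simp
    finally have fn: "(\<integral>\<^sup>+y. ennreal (norm (f' y) powr p) \<partial>lborel) = ennreal n" .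
    have Cl: "C / l \<ge> 0" using C l by simp
    note bounds = kernel_operator_bounds[of "K l" r A "C / l" f',
      OF K_borel K_zero A K_le Cl L2[OF l, unfolded T_def] f', folded T_def]
    have Tm: "T l f' \<in> borel_measurable borel" using bounds(1) by (simp add: T_def[abs_def])
    show ?thesis
    proof (cases "p = 1")
      case True
      have p1: "p\<^sub>1 = \<infinity>" using ennreal_conjugate_exponent[OF p(1) p1] True by simp
      have "ennreal (norm (T l f' x)) \<le> ennreal (A * n)" for x
        using bounds(2)[of x] fn True A n by (simp add: ennreal_mult[symmetric])
      then have sup: "esssup lebesgue (\<lambda>x. ennreal (norm (T l f' x))) \<le> ennreal (A * n)"
        using Tm by (intro esssup_I) (auto intro!: measurable_completion)
      then have "T l f' \<in> Lp_space p\<^sub>1 lebesgue"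
        using Tm by (auto simp: Lp_space_def p1 intro!: measurable_completion intro: le_less_trans)
      moreover have "Lp_norm p\<^sub>1 lebesgue (T l f') \<le> A * n"
        using enn2real_mono[OF sup] A n by (simp add: Lp_norm_def p1)
      \<comment> \<open>At \<open>p = 1\<close> the exponent of \<open>D / sqrt l\<close> is 0 and
        that of \<open>D\<close> is 1, so the claim is just \<open>A \<le> D\<close>.\<close>
      moreover have "A * n \<le> D powr (2 / p - 1) * (D / sqrt l) powr (2 * (1 - 1 / p)) * n powr (1 / p)"
        using True D l n AD by (simp add: mult_right_mono)
      ultimately show ?thesis unfolding osc norm_f by auto
    next
      case False
      \<comment> \<open>The finite conjugate exponent; \<open>p \<le> 2\<close> gives
        \<open>q \<ge> 2\<close>.\<close>
      define q where "q = p / (p - 1)"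
      have q: "q \<ge> 2" "p = q / (q - 1)" "1 / p = 1 - 1 / q"
        using p False by (auto simp: q_def field_simps)
      have p1: "p\<^sub>1 = ennreal q"
        using ennreal_conjugate_exponent[OF p(1) p1] False by (simp add: q_def)
      define X where "X = q * (q - 1) / 2 * (C / l) * A powr (q - 2) * n powr (q - 1)"
      have X: "X \<ge> 0" using q C l by (simp add: X_def)
      have "(\<integral>\<^sup>+x. ennreal (norm (T l f' x) powr q) \<partial>lborel) \<le> ennreal X"
        unfolding X_def by (rule bounds(3)[OF _ _ q(1,2) n fn])
      note Lp = Lp_space_lebesgue_bound[OF Tm _ X this]
      show ?thesis
        unfolding osc norm_f p1
        using Lp q interpolated_constant_bound[OF q(1) A C l n D_def q(3), folded X_def] by auto
    qed
  qed
  show ?thesis using D main by blast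
qed

end
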